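(* Let $(A,\mu,\Delta,r)$ be a quasi-triangular $\epsilon$-bialgebra and $\alpha\colon A\to A$ be an algebra morphism such that $\alpha^{\otimes 2}(r)=r$. Then $$A_\alpha=(A,\mu_\alpha,\Delta_\alpha,\alpha,r)$$ is a quasi-triangular $\epsilon$-Hom-bialgebra, where $\mu_\alpha=\alpha\circ\mu$ and $\Delta_\alpha=\Delta\circ\alpha$.
   Context: Throughout, $\mathbf{k}$ is a fixed field of characteristic $0$; vector spaces, linear maps and tensor products are over $\mathbf{k}$. Algebras are not required to be unital; an algebra morphism is a linear map commuting with the multiplications. An $\epsilon$-Hom-bialgebra $(A,\mu,\Delta,\alpha)$ is a $\mathbf{k}$-vector space $A$ with linear maps $\mu\colon A^{\otimes 2}\to A$, $\Delta\colon A\to A^{\otimes 2}$, $\alpha\colon A\to A$ such that: $\alpha\circ\mu=\mu\circ\alpha^{\otimes 2}$; $\mu\circ(\alpha\otimes\mu)=\mu\circ(\mu\otimes\alpha)$; $\alpha^{\otimes 2}\circ\Delta=\Delta\circ\alpha$; $(\alpha\otimes\Delta)\circ\Delta=(\Delta\otimes\alpha)\circ\Delta$; and $\Delta\circ\mu=(\mu\otimes\alpha)\circ(\alpha\otimes\Delta)+(\alpha\otimes\mu)\circ(\Delta\otimes\alpha)$. For $a\in A$ and $r=\sum u_i\otimes v_i\in A^{\otimes 2}$, set $[a,r]_*=\sum\mu(a,u_i)\otimes\alpha(v_i)-\alpha(u_i)\otimes\mu(v_i,a)$. A coboundary $\epsilon$-Hom-bialgebra $(A,\mu,\Delta,\alpha,r)$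 is an $\epsilon$-Hom-bialgebra $(A,\mu,\Delta,\alpha)$ together with an element $r\in A^{\otimes 2}$ with $\alpha^{\otimes 2}(r)=r$ such that $\Delta=[-,r]_*$. For $r=\sum u_i\otimes v_i$, set $$A(r)=\sum_{i,j}\mu(u_i,u_j)\otimes\alpha(v_j)\otimes\alpha(v_i)-\sum_{i,j}\alpha(u_i)\otimes\mu(v_i,u_j)\otimes\alpha(v_j)+\sum_{i,j}\alpha(u_j)\otimes\alpha(u_i)\otimes\mu(v_i,v_j)\in A^{\otimes 3}.$$ A quasi-triangular $\epsilon$-Hom-bialgebra is a coboundary $\epsilon$-Hom-bialgebra $(A,\mu,\Delta,\alpha,r)$ with $A(r)=0$ (the associative Hom-Yang-Baxter equation). A quasi-triangular $\epsilon$-bialgebra $(A,\mu,\Delta,r)$ is a quasi-triangular $\epsilon$-Hom-bialgebra with $\alpha=Id$. *)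

theory Defs
  imports "HOL-Algebra.Module" "HOL-Algebra.AbelCoset"
begin

text \<open>Maps are total functions of which only the values on carriers matter.\<close>

definition linear_map ::
  "('k, 'r) ring_scheme \<Rightarrow> ('k, 'a, 'm) module_scheme \<Rightarrow> ('k, 'b, 'n) module_scheme \<Rightarrow> ('a \<Rightarrow> 'b) \<Rightarrow> bool"
  where "linear_map K M N f \<longleftrightarrow>
    f \<in> carrier M \<rightarrow> carrier N \<and>
    (\<forall>x\<in>carrier M. \<forall>y\<in>carrier M. f (x \<oplus>\<^bsub>M\<^esub> y) = f x \<oplus>\<^bsub>N\<^esub> f y) \<and>
    (\<forall>c\<in>carrier K. \<forall>x\<in>carrier M. f (c \<odot>\<^bsub>M\<^esub> x) = c \<odot>\<^bsub>N\<^esub> f x)"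


section \<open>Tensor products\<close>

text \<open>
  The tensor product \<open>M \<otimes> N\<close> is the free module on \<open>carrier M \<times> carrier N\<close> modulo the submodule
  generated by the bilinearity relations; its elements are cosets. Modules reuse the ring record,
  whose multiplicative fields carry no information here and are left \<open>undefined\<close>.
\<close>

definition supp :: "('k, 'r) ring_scheme \<Rightarrow> ('x \<Rightarrow> 'k) \<Rightarrow> 'x set"
  where "supp K p = {x. p x \<noteq> \<zero>\<^bsub>K\<^esub>}"

definition free_module :: "('k, 'r) ring_scheme \<Rightarrow> 'x set \<Rightarrow> ('k, 'x \<Rightarrow> 'k) module"
  where "free_module K X =
    \<lparr>carrier = {p. range p \<subseteq> carrier K \<and> finite (supp K p) \<and> supp K p \<subseteq> X},
     mult = undefined, one = undefined,
     zero = (\<lambda>x. \<zero>\<^bsub>K\<^esub>), add = (\<lambda>p q x. p x \<oplus>\<^bsub>K\<^esub> q x),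
     smult = (\<lambda>c p x. c \<otimes>\<^bsub>K\<^esub> p x)\<rparr>"

definition free_gen :: "('k, 'r) ring_scheme \<Rightarrow> 'x \<Rightarrow> 'x \<Rightarrow> 'k"
  where "free_gen K x = (\<lambda>y. if y = x then \<one>\<^bsub>K\<^esub> else \<zero>\<^bsub>K\<^esub>)"

text \<open>The linear extension \<open>\<Sum> c\<^sub>i x\<^sub>i \<mapsto> \<Sum> c\<^sub>i \<phi>(x\<^sub>i)\<close> of a map \<open>\<phi>\<close> given on generators.\<close>

definition free_lift ::
  "('k, 'r) ring_scheme \<Rightarrow> ('k, 'c, 'm) module_scheme \<Rightarrow> ('x \<Rightarrow> 'c) \<Rightarrow> ('x \<Rightarrow> 'k) \<Rightarrow> 'c"
  where "free_lift K C \<phi> p = (\<Oplus>\<^bsub>C\<^esub>x\<in>supp K p. p x \<odot>\<^bsub>C\<^esub> \<phi> x)"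

definition submodule_span ::
  "('k, 'r) ring_scheme \<Rightarrow> ('k, 'a, 'm) module_scheme \<Rightarrow> 'a set \<Rightarrow> 'a set"
  where "submodule_span K M S = \<Inter>{H. submodule H K M \<and> S \<subseteq> H}"

definition quotient_module ::
  "('k, 'a, 'm) module_scheme \<Rightarrow> 'a set \<Rightarrow> ('k, 'a set) module"
  where "quotient_module M H =
    \<lparr>carrier = a_rcosets\<^bsub>M\<^esub> H, mult = undefined, one = undefined,
     zero = H, add = (\<lambda>X Y. X <+>\<^bsub>M\<^esub> Y),
     smult = (\<lambda>c X. \<Union>x\<in>X. H +>\<^bsub>M\<^esub> (c \<odot>\<^bsub>M\<^esub> x))\<rparr>"

definition bilinear_relations ::
  "('k, 'r) ring_scheme \<Rightarrow> ('k, 'a, 'm) module_scheme \<Rightarrow> ('k, 'b, 'n) module_scheme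
    \<Rightarrow> ('a \<times> 'b \<Rightarrow> 'k) set"
  where "bilinear_relations K M N =
    (let F = free_module K (carrier M \<times> carrier N); \<delta> = free_gen K in
      {\<delta> (x \<oplus>\<^bsub>M\<^esub> x', y) \<ominus>\<^bsub>F\<^esub> (\<delta> (x, y) \<oplus>\<^bsub>F\<^esub> \<delta> (x', y)) | x x' y.
          x \<in> carrier M \<and> x' \<in> carrier M \<and> y \<in> carrier N} \<union>
      {\<delta> (x, y \<oplus>\<^bsub>N\<^esub> y') \<ominus>\<^bsub>F\<^esub> (\<delta> (x, y) \<oplus>\<^bsub>F\<^esub> \<delta> (x, y')) | x y y'.
          x \<in> carrier M \<and> y \<in> carrier N \<and> y' \<in> carrier N} \<union>
      {\<delta> (c \<odot>\<^bsub>M\<^esub> x, y) \<ominus>\<^bsub>F\<^esub> c \<odot>\<^bsub>F\<^esub> \<delta> (x, y) | c x y.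
          c \<in> carrier K \<and> x \<in> carrier M \<and> y \<in> carrier N} \<union>
      {\<delta> (x, c \<odot>\<^bsub>N\<^esub> y) \<ominus>\<^bsub>F\<^esub> c \<odot>\<^bsub>F\<^esub> \<delta> (x, y) | c x y.
          c \<in> carrier K \<and> x \<in> carrier M \<and> y \<in> carrier N})"

definition tensor_null ::
  "('k, 'r) ring_scheme \<Rightarrow> ('k, 'a, 'm) module_scheme \<Rightarrow> ('k, 'b, 'n) module_scheme
    \<Rightarrow> ('a \<times> 'b \<Rightarrow> 'k) set"
  where "tensor_null K M N =
    submodule_span K (free_module K (carrier M \<times> carrier N)) (bilinear_relations K M N)"

definition tensor ::
  "('k, 'r) ring_scheme \<Rightarrow> ('k, 'a, 'm) module_scheme \<Rightarrow> ('k, 'b, 'n) module_scheme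
    \<Rightarrow> ('k, ('a \<times> 'b \<Rightarrow> 'k) set) module"
  where "tensor K M N =
    quotient_module (free_module K (carrier M \<times> carrier N)) (tensor_null K M N)"

definition pure_tensor ::
  "('k, 'r) ring_scheme \<Rightarrow> ('k, 'a, 'm) module_scheme \<Rightarrow> ('k, 'b, 'n) module_scheme
    \<Rightarrow> 'a \<Rightarrow> 'b \<Rightarrow> ('a \<times> 'b \<Rightarrow> 'k) set"
  where "pure_tensor K M N x y =
    tensor_null K M N +>\<^bsub>free_module K (carrier M \<times> carrier N)\<^esub> free_gen K (x, y)"

text \<open>
  \<open>tensor_lift K C \<phi> t\<close> is \<open>\<Sum> \<phi>(u\<^sub>i, v\<^sub>i)\<close> for \<open>t = \<Sum> u\<^sub>i \<otimes> v\<^sub>i\<close>. For bilinear \<open>\<phi>\<close> the value does not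
  depend on the chosen expression of \<open>t\<close>, i.e. \<open>free_lift\<close> is constant on the coset \<open>t\<close>. All
  formulas written with \<open>\<Sum> u\<^sub>i \<otimes> v\<^sub>i\<close> below are read in this way.
\<close>

definition tensor_lift ::
  "('k, 'r) ring_scheme \<Rightarrow> ('k, 'c, 'm) module_scheme \<Rightarrow> ('a \<Rightarrow> 'b \<Rightarrow> 'c)
    \<Rightarrow> ('a \<times> 'b \<Rightarrow> 'k) set \<Rightarrow> 'c"
  where "tensor_lift K C \<phi> t = the_elem (free_lift K C (\<lambda>(u, v). \<phi> u v) ` t)"

text \<open>\<open>tensor_map K M N f g\<close> is \<open>f \<otimes> g\<close>; here \<open>M\<close> and \<open>N\<close> are the codomains of \<open>f\<close> and \<open>g\<close>.\<close>

definition tensor_map ::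
  "('k, 'r) ring_scheme \<Rightarrow> ('k, 'c, 'm) module_scheme \<Rightarrow> ('k, 'd, 'n) module_scheme
    \<Rightarrow> ('a \<Rightarrow> 'c) \<Rightarrow> ('b \<Rightarrow> 'd) \<Rightarrow> ('a \<times> 'b \<Rightarrow> 'k) set \<Rightarrow> ('c \<times> 'd \<Rightarrow> 'k) set"
  where "tensor_map K M N f g =
    tensor_lift K (tensor K M N) (\<lambda>u v. pure_tensor K M N (f u) (g v))"

text \<open>
  \<open>A\<^sup>\<otimes>\<^sup>3\<close> is represented by \<open>A \<otimes> (A \<otimes> A)\<close>; the identifications with \<open>(A \<otimes> A) \<otimes> A\<close>, which are
  implicit in the usual notation, are \<open>(a \<otimes> b) \<otimes> c \<mapsto> a \<otimes> (b \<otimes> c)\<close> and its inverse.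
\<close>

definition assoc_right ::
  "('k, 'r) ring_scheme \<Rightarrow> ('k, 'a, 'm) module_scheme
    \<Rightarrow> (('a \<times> 'a \<Rightarrow> 'k) set \<times> 'a \<Rightarrow> 'k) set \<Rightarrow> ('a \<times> ('a \<times> 'a \<Rightarrow> 'k) set \<Rightarrow> 'k) set"
  where "assoc_right K A =
    tensor_lift K (tensor K A (tensor K A A))
      (\<lambda>t c. tensor_lift K (tensor K A (tensor K A A))
         (\<lambda>a b. pure_tensor K A (tensor K A A) a (pure_tensor K A A b c)) t)"

definition assoc_left ::
  "('k, 'r) ring_scheme \<Rightarrow> ('k, 'a, 'm) module_scheme
    \<Rightarrow> ('a \<times> ('a \<times> 'a \<Rightarrow> 'k) set \<Rightarrow> 'k) set \<Rightarrow> (('a \<times> 'a \<Rightarrow> 'k) set \<times> 'a \<Rightarrow> 'k) set"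
  where "assoc_left K A =
    tensor_lift K (tensor K (tensor K A A) A)
      (\<lambda>a t. tensor_lift K (tensor K (tensor K A A) A)
         (\<lambda>b c. pure_tensor K (tensor K A A) A (pure_tensor K A A a b) c) t)"


section \<open>\<open>\<epsilon>\<close>-Hom-bialgebras\<close>

locale field_of_char_0 = field K for K (structure) +
  assumes char_0: "n > 0 \<Longrightarrow> [(n::nat)] \<cdot> \<one> \<noteq> \<zero>"

text \<open>A \<open>K\<close>-vector space is a \<open>module\<close> over the field \<open>K\<close>.\<close>

locale epsilon_Hom_bialgebra =
  K?: field_of_char_0 K + A?: module K A for K (structure) and A (structure) +
  fixes \<mu> :: "('b \<times> 'b \<Rightarrow> 'a) set \<Rightarrow> 'b"
    and \<Delta> :: "'b \<Rightarrow> ('b \<times> 'b \<Rightarrow> 'a) set"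
    and \<alpha> :: "'b \<Rightarrow> 'b"
  assumes mult_linear: "linear_map K (tensor K A A) A \<mu>"
    and comult_linear: "linear_map K A (tensor K A A) \<Delta>"
    and twist_linear: "linear_map K A A \<alpha>"
    and twist_mult:
      "\<forall>x\<in>carrier (tensor K A A). \<alpha> (\<mu> x) = \<mu> (tensor_map K A A \<alpha> \<alpha> x)"
    and Hom_assoc:
      "\<forall>x\<in>carrier (tensor K A (tensor K A A)).
         \<mu> (tensor_map K A A \<alpha> \<mu> x) = \<mu> (tensor_map K A A \<mu> \<alpha> (assoc_left K A x))"
    and twist_comult:
      "\<forall>a\<in>carrier A. tensor_map K A A \<alpha> \<alpha> (\<Delta> a) = \<Delta> (\<alpha> a)"
    and Hom_coassoc:
      "\<forall>a\<in>carrier A. tensor_map K A (tensor K A A) \<alpha> \<Delta> (\<Delta> a) =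
         assoc_right K A (tensor_map K (tensor K A A) A \<Delta> \<alpha> (\<Delta> a))"
    and comult_mult:
      "\<forall>x\<in>carrier (tensor K A A).
         \<Delta> (\<mu> x) =
           tensor_map K A A \<mu> \<alpha> (assoc_left K A (tensor_map K A (tensor K A A) \<alpha> \<Delta> x))
           \<oplus>\<^bsub>tensor K A A\<^esub>
           tensor_map K A A \<alpha> \<mu> (assoc_right K A (tensor_map K (tensor K A A) A \<Delta> \<alpha> x))"

text \<open>\<open>[a, r]\<^sub>*\<close>\<close>

definition star_bracket ::
  "('k, 'r) ring_scheme \<Rightarrow> ('k, 'a, 'm) module_scheme
    \<Rightarrow> (('a \<times> 'a \<Rightarrow> 'k) set \<Rightarrow> 'a) \<Rightarrow> ('a \<Rightarrow> 'a) \<Rightarrow> 'a \<Rightarrow> ('a \<times> 'a \<Rightarrow> 'k) set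
    \<Rightarrow> ('a \<times> 'a \<Rightarrow> 'k) set"
  where "star_bracket K A \<mu> \<alpha> a r =
    tensor_lift K (tensor K A A)
      (\<lambda>u v. pure_tensor K A A (\<mu> (pure_tensor K A A a u)) (\<alpha> v)
          \<ominus>\<^bsub>tensor K A A\<^esub> pure_tensor K A A (\<alpha> u) (\<mu> (pure_tensor K A A v a))) r"

locale coboundary_epsilon_Hom_bialgebra = epsilon_Hom_bialgebra K A \<mu> \<Delta> \<alpha>
  for K (structure) and A (structure) and \<mu> \<Delta> \<alpha> +
  fixes r
  assumes r_closed: "r \<in> carrier (tensor K A A)"
    and twist_r: "tensor_map K A A \<alpha> \<alpha> r = r"
    and comult_eq: "\<forall>a\<in>carrier A. \<Delta> a = star_bracket K A \<mu> \<alpha> a r"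

text \<open>
  The element \<open>A(r)\<close>. In the double sum, \<open>r\<close> is written once as \<open>\<Sum> u \<otimes> v\<close> (index \<open>i\<close>) and once
  as \<open>\<Sum> u' \<otimes> v'\<close> (index \<open>j\<close>).
\<close>

definition AHYB ::
  "('k, 'r) ring_scheme \<Rightarrow> ('k, 'a, 'm) module_scheme
    \<Rightarrow> (('a \<times> 'a \<Rightarrow> 'k) set \<Rightarrow> 'a) \<Rightarrow> ('a \<Rightarrow> 'a) \<Rightarrow> ('a \<times> 'a \<Rightarrow> 'k) set
    \<Rightarrow> ('a \<times> ('a \<times> 'a \<Rightarrow> 'k) set \<Rightarrow> 'k) set"
  where "AHYB K A \<mu> \<alpha> r =
    (let A2 = tensor K A A; A3 = tensor K A A2;
         t2 = pure_tensor K A A; t3 = (\<lambda>x y z. pure_tensor K A A2 x (t2 y z))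
     in tensor_lift K A3 (\<lambda>u v. tensor_lift K A3 (\<lambda>u' v'.
            (t3 (\<mu> (t2 u u')) (\<alpha> v') (\<alpha> v) \<ominus>\<^bsub>A3\<^esub> t3 (\<alpha> u) (\<mu> (t2 v u')) (\<alpha> v'))
            \<oplus>\<^bsub>A3\<^esub> t3 (\<alpha> u') (\<alpha> u) (\<mu> (t2 v v'))) r) r)"

locale quasi_triangular_epsilon_Hom_bialgebra = coboundary_epsilon_Hom_bialgebra K A \<mu> \<Delta> \<alpha> r
  for K (structure) and A (structure) and \<mu> \<Delta> \<alpha> r +
  assumes AHYBE: "AHYB K A \<mu> \<alpha> r = \<zero>\<^bsub>tensor K A (tensor K A A)\<^esub>"

locale quasi_triangular_epsilon_bialgebra = quasi_triangular_epsilon_Hom_bialgebra K A \<mu> \<Delta> id r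
  for K (structure) and A (structure) and \<mu> \<Delta> r

definition algebra_morphism ::
  "('k, 'r) ring_scheme
    \<Rightarrow> ('k, 'a, 'm) module_scheme \<Rightarrow> (('a \<times> 'a \<Rightarrow> 'k) set \<Rightarrow> 'a)
    \<Rightarrow> ('k, 'b, 'n) module_scheme \<Rightarrow> (('b \<times> 'b \<Rightarrow> 'k) set \<Rightarrow> 'b) \<Rightarrow> ('a \<Rightarrow> 'b) \<Rightarrow> bool"
  where "algebra_morphism K A \<mu> B \<nu> f \<longleftrightarrow>
    linear_map K A B f \<and>
    (\<forall>x\<in>carrier (tensor K A A). f (\<mu> x) = \<nu> (tensor_map K B B f f x))"

end

theory Submission
  imports Defs
begin

text \<open>
  Evaluating both sides on \<open>r = (\<alpha> \<otimes> \<alpha>) r\<close> shows that the twisted \<open>[a, r]\<^sub>*\<close> equals both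
  \<open>(\<alpha> \<otimes> \<alpha>) (\<Delta> a)\<close> and \<open>\<Delta> (\<alpha> a)\<close>; hence \<open>\<alpha>\<close> is a coalgebra morphism as well. The powers of \<open>\<alpha>\<close> then
  factor out of each axiom of the twisted structure, leaving the corresponding untwisted axiom, and
  the twisted \<open>A(r)\<close> is the image of the untwisted one under \<open>\<alpha> \<otimes> \<alpha> \<otimes> \<alpha>\<close>. All this is checked on
  pure tensors by the universal property of the tensor product.
\<close>

section \<open>Linear maps and quotients\<close>

lemma linear_mapI:
  assumes "\<And>x. x \<in> carrier M \<Longrightarrow> f x \<in> carrier N"
    and "\<And>x y. \<lbrakk>x \<in> carrier M; y \<in> carrier M\<rbrakk> \<Longrightarrow> f (x \<oplus>\<^bsub>M\<^esub> y) = f x \<oplus>\<^bsub>N\<^esub> f y"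
    and "\<And>c x. \<lbrakk>c \<in> carrier R; x \<in> carrier M\<rbrakk> \<Longrightarrow> f (c \<odot>\<^bsub>M\<^esub> x) = c \<odot>\<^bsub>N\<^esub> f x"
  shows "linear_map R M N f"
  using assms unfolding linear_map_def by auto

lemma linear_map_closed: "\<lbrakk>linear_map R M N f; x \<in> carrier M\<rbrakk> \<Longrightarrow> f x \<in> carrier N"
  unfolding linear_map_def by auto

lemma linear_map_add:
  "\<lbrakk>linear_map R M N f; x \<in> carrier M; y \<in> carrier M\<rbrakk> \<Longrightarrow> f (x \<oplus>\<^bsub>M\<^esub> y) = f x \<oplus>\<^bsub>N\<^esub> f y"
  unfolding linear_map_def by auto

lemma linear_map_smult:
  "\<lbrakk>linear_map R M N f; c \<in> carrier R; x \<in> carrier M\<rbrakk> \<Longrightarrow> f (c \<odot>\<^bsub>M\<^esub> x) = c \<odot>\<^bsub>N\<^esub> f x"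
  unfolding linear_map_def by auto

lemma linear_map_compose:
  assumes "linear_map R M N f" and "linear_map R N P g"
  shows "linear_map R M P (\<lambda>x. g (f x))"
  using assms by (auto intro!: linear_mapI simp: linear_map_def Pi_iff)

lemma linear_map_id: "linear_map R M M id"
  by (rule linear_mapI) auto

text \<open>Maps are total functions, and linearity constrains only their values on the carrier. The
  domain is a module, so sums and multiples stay in the region where the two maps agree.\<close>

lemma linear_map_cong:
  assumes "module R M" and "linear_map R M N f" and "\<And>x. x \<in> carrier M \<Longrightarrow> g x = f x"
  shows "linear_map R M N g"
proof -
  interpret M: module R M by fact
  show ?thesis
    using assms(2,3) by (auto intro!: linear_mapI simp: linear_map_def Pi_iff)
qed

context cring
begin

text \<open>Zero is its own multiple by the scalar \<open>\<zero>\<close>, so compatibility with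
  scalars alone gives the claim. The rule for negatives works in the same way with the scalar
  -1.\<close>

lemma linear_map_zero:
  assumes "module R M" "module R N" "linear_map R M N f"
  shows "f \<zero>\<^bsub>M\<^esub> = \<zero>\<^bsub>N\<^esub>"
proof -
  interpret M: module R M by fact
  interpret N: module R N by fact
  show ?thesis
    using linear_map_smult[OF assms(3) zero_closed M.M.zero_closed]
    by (simp add: linear_map_closed[OF assms(3)])
qed

lemma linear_map_a_inv:
  assumes "module R M" "module R N" "linear_map R M N f" "x \<in> carrier M"
  shows "f (\<ominus>\<^bsub>M\<^esub> x) = \<ominus>\<^bsub>N\<^esub> f x"
proof -
  interpret M: module R M by fact
  interpret N: module R N by fact
  show ?thesis
    using linear_map_smult[OF assms(3), of "\<ominus> \<one>" x] assms(4)
    by (simp add: M.smult_l_minus N.smult_l_minus linear_map_closed[OF assms(3)])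
qed

lemma linear_map_minus:
  assumes "module R M" "module R N" "linear_map R M N f" "x \<in> carrier M" "y \<in> carrier M"
  shows "f (x \<ominus>\<^bsub>M\<^esub> y) = f x \<ominus>\<^bsub>N\<^esub> f y"
proof -
  interpret M: module R M by fact
  show ?thesis
    using assms(4,5)
    by (simp add: a_minus_def linear_map_add[OF assms(3)] linear_map_a_inv[OF assms(1-3)])
qed

lemma linear_map_plus:
  assumes "module R N" "linear_map R M N f" "linear_map R M N g"
  shows "linear_map R M N (\<lambda>x. f x \<oplus>\<^bsub>N\<^esub> g x)"
proof -
  interpret N: module R N by fact
  note closed = assms(2,3)[THEN linear_map_closed]
  show ?thesis
    by (rule linear_mapI)
      (simp_all add: closed assms(2,3)[THEN linear_map_add] assms(2,3)[THEN linear_map_smult]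
        N.smult_r_distr N.M.add.m_ac)
qed

lemma linear_map_uminus:
  assumes "module R N" "linear_map R M N f"
  shows "linear_map R M N (\<lambda>x. \<ominus>\<^bsub>N\<^esub> f x)"
proof -
  interpret N: module R N by fact
  note closed = assms(2)[THEN linear_map_closed]
  show ?thesis
    by (rule linear_mapI)
      (simp_all add: closed assms(2)[THEN linear_map_add] assms(2)[THEN linear_map_smult]
        N.smult_r_minus N.M.minus_add)
qed

lemma linear_map_diff:
  assumes "module R N" "linear_map R M N f" "linear_map R M N g"
  shows "linear_map R M N (\<lambda>x. f x \<ominus>\<^bsub>N\<^esub> g x)"
  unfolding a_minus_def by (intro linear_map_plus linear_map_uminus assms)

text \<open>Commutativity of the ring lets \<open>c\<close> pass the scalar pulled out of
  \<open>f\<close>.\<close>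

lemma linear_map_scaled:
  assumes "module R N" "linear_map R M N f" "c \<in> carrier R"
  shows "linear_map R M N (\<lambda>x. c \<odot>\<^bsub>N\<^esub> f x)"
proof -
  interpret N: module R N by fact
  note closed = assms(2)[THEN linear_map_closed]
  show ?thesis
    by (rule linear_mapI)
      (simp_all add: assms(3) closed assms(2)[THEN linear_map_add] assms(2)[THEN linear_map_smult]
        N.smult_r_distr N.smult_assoc1[symmetric] m_comm)
qed

section \<open>Submodules: kernels and spans\<close>

lemma submodule_kernel:
  assumes "module R M" "module R N" "linear_map R M N f"
  shows "submodule {x \<in> carrier M. f x = \<zero>\<^bsub>N\<^esub>} R M"
proof -
  interpret M: module R M by fact
  interpret N: module R N by fact
  show ?thesis
    by (rule M.submoduleI)
      (simp_all add: linear_map_zero[OF assms] linear_map_a_inv[OF assms]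
        linear_map_add[OF assms(3)] linear_map_smult[OF assms(3)])
qed

lemma submodule_submodule_span:
  assumes "module R M" "S \<subseteq> carrier M"
  shows "submodule (submodule_span R M S) R M"
proof -
  interpret M: module R M by fact
  note E = M.submoduleE
  have zero: "\<zero>\<^bsub>M\<^esub> \<in> H" if "submodule H R M" for H
    using that by (metis submodule.axioms(1) subgroup.one_closed monoid.simps(2))
  \<comment> \<open>This member of the intersected family forces the intersection into the carrier;
    over an empty family the intersection would be everything.\<close>
  have "carrier M \<in> {H. submodule H R M \<and> S \<subseteq> H}"
    using assms(2) M.carrier_is_submodule by simp
  then show ?thesis
    unfolding submodule_span_def
    by (intro M.submoduleI Inter_lower) (auto intro: zero E(3-5))
qed

lemma submodule_span_superset: "S \<subseteq> submodule_span R M S"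
  unfolding submodule_span_def by blast

lemma submodule_span_least: "\<lbrakk>submodule H R M; S \<subseteq> H\<rbrakk> \<Longrightarrow> submodule_span R M S \<subseteq> H"
  unfolding submodule_span_def by blast

end

section \<open>Quotient modules\<close>

lemma abelian_subgroup_submodule:
  assumes "module R M" "submodule H R M"
  shows "abelian_subgroup H M"
  using assms
  by (meson abelian_subgroupI3 additive_subgroup.intro module.axioms(2) submodule.axioms(1))

context cring
begin

lemma quotient_add:
  assumes "module R M" "submodule H R M" "x \<in> carrier M" "y \<in> carrier M"
  shows "(H +>\<^bsub>M\<^esub> x) \<oplus>\<^bsub>quotient_module M H\<^esub> (H +>\<^bsub>M\<^esub> y) = H +>\<^bsub>M\<^esub> (x \<oplus>\<^bsub>M\<^esub> y)"
proof -
  interpret abelian_subgroup H M by (rule abelian_subgroup_submodule) fact+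
  show ?thesis using assms by (simp add: quotient_module_def a_rcos_sum)
qed

text \<open>Two elements of a coset differ by some \<open>h\<close> in \<open>H\<close>, and the
  multiple of \<open>h\<close> by \<open>c\<close> lies in \<open>H\<close> again. So the union that
  defines scaling in the quotient ranges over copies of one and the same coset.\<close>

lemma quotient_smult:
  assumes "module R M" "submodule H R M" "c \<in> carrier R" "y \<in> carrier M"
  shows "c \<odot>\<^bsub>quotient_module M H\<^esub> (H +>\<^bsub>M\<^esub> y) = H +>\<^bsub>M\<^esub> (c \<odot>\<^bsub>M\<^esub> y)"
proof -
  interpret M: module R M by fact
  interpret abelian_subgroup H M by (rule abelian_subgroup_submodule) fact+
  interpret S: submodule H R M by fact
  have "H +>\<^bsub>M\<^esub> (c \<odot>\<^bsub>M\<^esub> x) = H +>\<^bsub>M\<^esub> (c \<odot>\<^bsub>M\<^esub> y)" if "x \<in> H +>\<^bsub>M\<^esub> y" for x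
  proof -
    from that obtain h where h: "h \<in> H" "x = h \<oplus>\<^bsub>M\<^esub> y"
      by (auto simp: a_r_coset_def')
    then have "c \<odot>\<^bsub>M\<^esub> x = c \<odot>\<^bsub>M\<^esub> h \<oplus>\<^bsub>M\<^esub> c \<odot>\<^bsub>M\<^esub> y"
      using assms a_subset by (auto simp: M.smult_r_distr)
    then have "c \<odot>\<^bsub>M\<^esub> x \<in> H +>\<^bsub>M\<^esub> (c \<odot>\<^bsub>M\<^esub> y)"
      using h assms by (auto simp: a_r_coset_def' intro!: bexI[of _ "c \<odot>\<^bsub>M\<^esub> h"])
    then show ?thesis
      using a_repr_independence' assms by (metis M.smult_closed)
  qed
  \<comment> \<open>At least one representative is needed, since otherwise the union would be
    empty.\<close>
  moreover have "y \<in> H +>\<^bsub>M\<^esub> y" using assms by (intro a_rcos_self)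
  ultimately have "(\<Union>x\<in>H +>\<^bsub>M\<^esub> y. H +>\<^bsub>M\<^esub> (c \<odot>\<^bsub>M\<^esub> x)) = H +>\<^bsub>M\<^esub> (c \<odot>\<^bsub>M\<^esub> y)"
    by blast
  then show ?thesis by (simp add: quotient_module_def)
qed

lemma quotient_carrier: "carrier (quotient_module M H) = (\<lambda>x. H +>\<^bsub>M\<^esub> x) ` carrier M"
  by (auto simp: quotient_module_def A_RCOSETS_def')

lemma quotient_zero:
  assumes "module R M" "submodule H R M"
  shows "\<zero>\<^bsub>quotient_module M H\<^esub> = H +>\<^bsub>M\<^esub> \<zero>\<^bsub>M\<^esub>"
proof -
  interpret abelian_subgroup H M by (rule abelian_subgroup_submodule) fact+
  show ?thesis using a_subset by (simp add: quotient_module_def)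
qed

text \<open>Every element is the coset of a representative and all operations are computed on
  representatives, so each law is inherited from \<open>M\<close>.\<close>

lemma module_quotient:
  assumes "module R M" "submodule H R M"
  shows "module R (quotient_module M H)"
proof -
  interpret M: module R M by fact
  note simps = quotient_carrier quotient_zero[OF assms] quotient_add[OF assms]
    quotient_smult[OF assms]
  have rep: "\<exists>a\<in>carrier M. x = H +>\<^bsub>M\<^esub> a" if "x \<in> carrier (quotient_module M H)" for x
    using that unfolding quotient_carrier by blast
  have "abelian_group (quotient_module M H)"
  proof (rule abelian_groupI, goal_cases)
    case (1 x y)
    then show ?case by (auto dest!: rep simp: simps)
  next
    case 2
    then show ?case by (simp add: simps)
  next
    case (3 x y z)
    then show ?case by (auto dest!: rep simp: simps M.M.a_assoc)
  next
    case (4 x y)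
    then show ?case by (auto dest!: rep simp: simps M.M.a_comm)
  next
    case (5 x)
    then show ?case by (auto dest!: rep simp: simps)
  next
    case (6 x)
    then obtain a where a: "a \<in> carrier M" "x = H +>\<^bsub>M\<^esub> a"
      using rep by blast
    then show ?case
      by (intro bexI[of _ "H +>\<^bsub>M\<^esub> (\<ominus>\<^bsub>M\<^esub> a)"]) (simp_all add: simps M.M.l_neg)
  qed
  then show ?thesis
  proof (rule moduleI[OF cring_axioms], goal_cases)
    case (1 c x)
    then show ?case by (auto dest!: rep simp: simps)
  next
    case (2 c d x)
    then show ?case by (auto dest!: rep simp: simps M.smult_l_distr)
  next
    case (3 c x y)
    then show ?case by (auto dest!: rep simp: simps M.smult_r_distr)
  next
    case (4 c d x)
    then show ?case by (auto dest!: rep simp: simps M.smult_assoc1)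
  next
    case (5 x)
    then show ?case by (auto dest!: rep simp: simps)
  qed
qed

lemma linear_map_quotient:
  assumes "module R M" "submodule H R M"
  shows "linear_map R M (quotient_module M H) (\<lambda>x. H +>\<^bsub>M\<^esub> x)"
  by (rule linear_mapI)
    (simp_all add: quotient_carrier quotient_add[OF assms] quotient_smult[OF assms])

end

section \<open>Free modules\<close>

lemma supp_subset: "(\<And>x. x \<notin> S \<Longrightarrow> p x = \<zero>\<^bsub>R\<^esub>) \<Longrightarrow> supp R p \<subseteq> S"
  unfolding supp_def by blast

text \<open>Pointwise unfolding suits the verification of the module laws. Later proofs remove these
  rules from the simplifier, so that the operations stay abstract and linearity of maps out of the
  free module can rewrite them.\<close>

lemma free_module_simps [simp]:
  "\<zero>\<^bsub>free_module R X\<^esub> = (\<lambda>x. \<zero>\<^bsub>R\<^esub>)"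
  "p \<oplus>\<^bsub>free_module R X\<^esub> q = (\<lambda>x. p x \<oplus>\<^bsub>R\<^esub> q x)"
  "c \<odot>\<^bsub>free_module R X\<^esub> p = (\<lambda>x. c \<otimes>\<^bsub>R\<^esub> p x)"
  by (simp_all add: free_module_def)

text \<open>Any finite set outside which \<open>p\<close> vanishes will do, so the exact support of
  a sum, which cancellation may shrink, never has to be computed.\<close>

lemma free_moduleI:
  assumes "\<And>x. p x \<in> carrier R" "finite S" "S \<subseteq> X" "\<And>x. x \<notin> S \<Longrightarrow> p x = \<zero>\<^bsub>R\<^esub>"
  shows "p \<in> carrier (free_module R X)"
proof -
  have "supp R p \<subseteq> S" by (rule supp_subset) fact
  then show ?thesis
    using assms(1-3) by (auto simp: free_module_def intro: finite_subset)
qed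

lemma free_moduleD:
  assumes "p \<in> carrier (free_module R X)"
  shows "p x \<in> carrier R" "finite (supp R p)" "supp R p \<subseteq> X" "x \<notin> supp R p \<Longrightarrow> p x = \<zero>\<^bsub>R\<^esub>"
  using assms by (auto simp: free_module_def supp_def)

context cring
begin

lemma module_free_module: "module R (free_module R X)"
proof -
  let ?F = "free_module R X"
  have add: "p \<oplus>\<^bsub>?F\<^esub> q \<in> carrier ?F" if "p \<in> carrier ?F" "q \<in> carrier ?F" for p q
    by (rule free_moduleI[where S = "supp R p \<union> supp R q"])
      (simp_all add: free_moduleD[OF that(1)] free_moduleD[OF that(2)])
  have smult: "c \<odot>\<^bsub>?F\<^esub> p \<in> carrier ?F" if "c \<in> carrier R" "p \<in> carrier ?F" for c p
    by (rule free_moduleI[where S = "supp R p"]) (simp_all add: that(1) free_moduleD[OF that(2)])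
  have zero: "\<zero>\<^bsub>?F\<^esub> \<in> carrier ?F"
    by (rule free_moduleI[where S = "{}"]) auto
  have neg: "\<exists>q\<in>carrier ?F. q \<oplus>\<^bsub>?F\<^esub> p = \<zero>\<^bsub>?F\<^esub>" if "p \<in> carrier ?F" for p
  proof (rule bexI)
    \<comment> \<open>The additive inverse is written as a multiple by -1, whose membership in the
      carrier follows from \<open>smult\<close>.\<close>
    show "(\<ominus> \<one>) \<odot>\<^bsub>?F\<^esub> p \<oplus>\<^bsub>?F\<^esub> p = \<zero>\<^bsub>?F\<^esub>"
      by (simp add: fun_eq_iff l_minus l_neg free_moduleD(1)[OF that])
  qed (use smult that in blast)
  have ab: "abelian_group ?F"
    by (rule abelian_groupI;
        ((rule add zero neg; assumption) | simp add: fun_eq_iff free_moduleD(1) a_ac))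
  show ?thesis
    by (rule moduleI[OF cring_axioms ab];
        ((rule smult; assumption) |
          simp add: fun_eq_iff free_moduleD(1) l_distr r_distr m_assoc))
qed

lemma free_gen_closed: "x \<in> X \<Longrightarrow> free_gen R x \<in> carrier (free_module R X)"
  by (rule free_moduleI[where S = "{x}"]) (auto simp: free_gen_def)

lemma free_module_induct [consumes 1, case_names zero add]:
  assumes "p \<in> carrier (free_module R X)"
    and zero: "P \<zero>\<^bsub>free_module R X\<^esub>"
    and add: "\<And>p c x. \<lbrakk>p \<in> carrier (free_module R X); P p; c \<in> carrier R; x \<in> X\<rbrakk> \<Longrightarrow>
      P (p \<oplus>\<^bsub>free_module R X\<^esub> c \<odot>\<^bsub>free_module R X\<^esub> free_gen R x)"
  shows "P p"
proof -
  \<comment> \<open>The induction runs over a finite set containing the support, not over the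
    support itself, so the value at the removed point may be zero. Clearing that value gives
    \<open>q\<close>, and \<open>p\<close> is recovered by adding back one multiple of a
    generator.\<close>
  have "finite S \<Longrightarrow> S \<subseteq> X \<Longrightarrow> range p \<subseteq> carrier R \<Longrightarrow> (\<forall>x. x \<notin> S \<longrightarrow> p x = \<zero>) \<Longrightarrow> P p" for S
  proof (induction S arbitrary: p rule: finite_induct)
    case empty
    then have "p = \<zero>\<^bsub>free_module R X\<^esub>" by auto
    then show ?case using zero by simp
  next
    case (insert x S)
    define q where "q = p(x := \<zero>)"
    have ran: "range q \<subseteq> carrier R" using insert.prems(2) by (auto simp: q_def)
    have out: "\<forall>y. y \<notin> S \<longrightarrow> q y = \<zero>" using insert.prems(3) by (auto simp: q_def)
    have "P q" using insert.IH[of q] insert.prems(1) ran out by auto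
    moreover have "q \<in> carrier (free_module R X)"
      by (rule free_moduleI[where S = S]) (use insert ran out in auto)
    moreover have "p = q \<oplus>\<^bsub>free_module R X\<^esub> p x \<odot>\<^bsub>free_module R X\<^esub> free_gen R x"
      using insert.prems(2) by (auto simp: q_def free_gen_def fun_eq_iff image_subset_iff)
    ultimately show ?case
      using add[of q "p x" x] insert.prems(1,2) by auto
  qed
  then show ?thesis
    using free_moduleD[OF assms(1)] by (metis image_subset_iff)
qed

text \<open>Terms outside the support have coefficient zero. The freedom in the index set makes sums
  over different supports comparable.\<close>

lemma free_lift_superset:
  assumes "module R C" "\<phi> \<in> X \<rightarrow> carrier C" "p \<in> carrier (free_module R X)"
    and "finite S" "supp R p \<subseteq> S" "S \<subseteq> X"
  shows "free_lift R C \<phi> p = (\<Oplus>\<^bsub>C\<^esub>x\<in>S. p x \<odot>\<^bsub>C\<^esub> \<phi> x)"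
proof -
  interpret C: module R C by fact
  have "\<phi> x \<in> carrier C" if "x \<in> S" for x using assms(2,6) that by blast
  then show ?thesis
    unfolding free_lift_def
    by (intro C.M.add.finprod_mono_neutral_cong_left assms(4,5))
      (simp_all add: free_moduleD[OF assms(3)])
qed

lemma free_lift_linear:
  assumes "module R C" "\<phi> \<in> X \<rightarrow> carrier C"
  shows "linear_map R (free_module R X) C (free_lift R C \<phi>)"
proof -
  interpret C: module R C by fact
  interpret F: module R "free_module R X" by (rule module_free_module)
  note sup = free_lift_superset[OF assms]
  show ?thesis
  proof (rule linear_mapI)
    fix p assume p: "p \<in> carrier (free_module R X)"
    then show "free_lift R C \<phi> p \<in> carrier C"
      unfolding free_lift_def using assms(2) free_moduleD[OF p]
      by (intro C.M.add.finprod_closed) auto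
    fix q assume q: "q \<in> carrier (free_module R X)"
    \<comment> \<open>The functions \<open>p\<close>, \<open>q\<close> and their sum may have three
      different supports; this set contains all of them.\<close>
    let ?S = "supp R p \<union> supp R q"
    have S: "finite ?S" "supp R p \<subseteq> ?S" "supp R q \<subseteq> ?S" "?S \<subseteq> X"
      using free_moduleD[OF p] free_moduleD[OF q] by auto
    then have \<phi>: "\<phi> x \<in> carrier C" if "x \<in> ?S" for x using assms(2) that by blast
    have pq: "p \<oplus>\<^bsub>free_module R X\<^esub> q \<in> carrier (free_module R X)"
      using p q by (rule F.M.a_closed)
    have T: "supp R (p \<oplus>\<^bsub>free_module R X\<^esub> q) \<subseteq> ?S"
      by (rule supp_subset) (simp add: free_moduleD(4)[OF p] free_moduleD(4)[OF q])
    have "free_lift R C \<phi> (p \<oplus>\<^bsub>free_module R X\<^esub> q)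
        = (\<Oplus>\<^bsub>C\<^esub>x\<in>?S. p x \<odot>\<^bsub>C\<^esub> \<phi> x \<oplus>\<^bsub>C\<^esub> q x \<odot>\<^bsub>C\<^esub> \<phi> x)"
      unfolding sup[OF pq S(1) T S(4)]
      by (rule C.M.add.finprod_cong'[OF refl])
        (simp_all add: C.smult_l_distr \<phi> free_moduleD(1)[OF p] free_moduleD(1)[OF q])
    also have "\<dots> = free_lift R C \<phi> p \<oplus>\<^bsub>C\<^esub> free_lift R C \<phi> q"
      unfolding sup[OF p S(1,2,4)] sup[OF q S(1,3,4)]
      by (rule C.M.add.finprod_multf) (simp_all add: \<phi> free_moduleD(1)[OF p] free_moduleD(1)[OF q])
    finally show "free_lift R C \<phi> (p \<oplus>\<^bsub>free_module R X\<^esub> q)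
        = free_lift R C \<phi> p \<oplus>\<^bsub>C\<^esub> free_lift R C \<phi> q" .
  next
    fix c p assume c: "c \<in> carrier R" and p: "p \<in> carrier (free_module R X)"
    let ?S = "supp R p"
    have S: "finite ?S" "?S \<subseteq> ?S" "?S \<subseteq> X"
      using free_moduleD[OF p] by auto
    then have \<phi>: "\<phi> x \<in> carrier C" if "x \<in> ?S" for x using assms(2) that by blast
    have cp: "c \<odot>\<^bsub>free_module R X\<^esub> p \<in> carrier (free_module R X)"
      using c p by (rule F.smult_closed)
    have T: "supp R (c \<odot>\<^bsub>free_module R X\<^esub> p) \<subseteq> ?S"
      by (rule supp_subset) (simp add: free_moduleD(4)[OF p] c)
    show "free_lift R C \<phi> (c \<odot>\<^bsub>free_module R X\<^esub> p) = c \<odot>\<^bsub>C\<^esub> free_lift R C \<phi> p"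
      unfolding sup[OF p S] sup[OF cp S(1) T S(3)]
      by (subst C.finsum_smult_ldistr)
        (auto intro!: C.M.add.finprod_cong'
          simp: C.smult_assoc1 S(1) c \<phi> free_moduleD(1)[OF p])
  qed
qed

lemma free_lift_gen:
  assumes "module R C" "\<phi> \<in> X \<rightarrow> carrier C" "x \<in> X"
  shows "free_lift R C \<phi> (free_gen R x) = \<phi> x"
proof -
  interpret C: module R C by fact
  \<comment> \<open>Only the inclusion holds in general: over the zero ring the support of a
    generator is empty.\<close>
  have "supp R (free_gen R x) \<subseteq> {x}"
    by (rule supp_subset) (simp add: free_gen_def)
  then have "free_lift R C \<phi> (free_gen R x) = (\<Oplus>\<^bsub>C\<^esub>y\<in>{x}. free_gen R x y \<odot>\<^bsub>C\<^esub> \<phi> y)"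
    using free_lift_superset[OF assms(1,2) free_gen_closed[OF assms(3)], of "{x}"] assms(3) by simp
  also have "\<dots> = \<phi> x"
    using funcset_mem[OF assms(2,3)] by (simp add: free_gen_def)
  finally show ?thesis .
qed

end

section \<open>The universal property of the tensor product\<close>

text \<open>Linearity in each variable is phrased through \<open>linear_map\<close>, so that the
  rules for composing, adding and scaling linear maps apply to one variable at a time.\<close>

definition bilinear ::
  "('k, 'r) ring_scheme \<Rightarrow> ('k, 'a, 'm) module_scheme \<Rightarrow> ('k, 'b, 'n) module_scheme
    \<Rightarrow> ('k, 'c, 'l) module_scheme \<Rightarrow> ('a \<Rightarrow> 'b \<Rightarrow> 'c) \<Rightarrow> bool"
  where "bilinear R M N C \<phi> \<longleftrightarrow>
    (\<forall>x\<in>carrier M. linear_map R N C (\<phi> x)) \<and> (\<forall>y\<in>carrier N. linear_map R M C (\<lambda>x. \<phi> x y))"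

lemma bilinearI:
  assumes "\<And>x. x \<in> carrier M \<Longrightarrow> linear_map R N C (\<lambda>y. \<phi> x y)"
    and "\<And>y. y \<in> carrier N \<Longrightarrow> linear_map R M C (\<lambda>x. \<phi> x y)"
  shows "bilinear R M N C \<phi>"
  using assms unfolding bilinear_def by auto

lemma bilinear_left: "\<lbrakk>bilinear R M N C \<phi>; y \<in> carrier N\<rbrakk> \<Longrightarrow> linear_map R M C (\<lambda>x. \<phi> x y)"
  unfolding bilinear_def by auto

lemma bilinear_right: "\<lbrakk>bilinear R M N C \<phi>; x \<in> carrier M\<rbrakk> \<Longrightarrow> linear_map R N C (\<phi> x)"
  unfolding bilinear_def by auto

lemma bilinear_closed:
  "\<lbrakk>bilinear R M N C \<phi>; x \<in> carrier M; y \<in> carrier N\<rbrakk> \<Longrightarrow> \<phi> x y \<in> carrier C"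
  by (rule linear_map_closed[OF bilinear_right])

context cring
begin

lemma bilinear_relations_closed:
  assumes "module R M" "module R N"
  shows "bilinear_relations R M N \<subseteq> carrier (free_module R (carrier M \<times> carrier N))"
proof -
  interpret M: module R M by fact
  interpret N: module R N by fact
  interpret F: module R "free_module R (carrier M \<times> carrier N)" by (rule module_free_module)
  note [simp del] = free_module_simps
  show ?thesis
    unfolding bilinear_relations_def Let_def
    by (intro Un_least subsetI; elim CollectE exE conjE; hypsubst)
      (intro F.M.minus_closed F.M.a_closed F.smult_closed free_gen_closed SigmaI
        M.M.a_closed N.M.a_closed M.smult_closed N.smult_closed; assumption)+
qed

lemma submodule_tensor_null:
  assumes "module R M" "module R N"
  shows "submodule (tensor_null R M N) R (free_module R (carrier M \<times> carrier N))"
  unfolding tensor_null_def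
  by (intro submodule_submodule_span module_free_module bilinear_relations_closed assms)

lemma module_tensor: "\<lbrakk>module R M; module R N\<rbrakk> \<Longrightarrow> module R (tensor R M N)"
  unfolding tensor_def by (intro module_quotient module_free_module submodule_tensor_null)

lemma tensor_coset_linear:
  assumes "module R M" "module R N"
  shows "linear_map R (free_module R (carrier M \<times> carrier N)) (tensor R M N)
    (\<lambda>p. tensor_null R M N +>\<^bsub>free_module R (carrier M \<times> carrier N)\<^esub> p)"
  unfolding tensor_def
  by (intro linear_map_quotient module_free_module submodule_tensor_null assms)

text \<open>The kernel of the lift is a submodule, and bilinearity puts every generating relation
  into it. Hence it contains the span of the relations.\<close>

lemma free_lift_tensor_null:
  assumes "module R M" "module R N" "module R C" "bilinear R M N C \<phi>" "p \<in> tensor_null R M N"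
  shows "free_lift R C (\<lambda>(u, v). \<phi> u v) p = \<zero>\<^bsub>C\<^esub>"
proof -
  interpret M: module R M by fact
  interpret N: module R N by fact
  interpret C: module R C by fact
  let ?F = "free_module R (carrier M \<times> carrier N)"
  let ?f = "free_lift R C (\<lambda>(u, v). \<phi> u v)"
  interpret F: module R ?F by (rule module_free_module)
  note [simp del] = free_module_simps
  have \<phi>: "(\<lambda>(u, v). \<phi> u v) \<in> carrier M \<times> carrier N \<rightarrow> carrier C"
    using bilinear_closed[OF assms(4)] by auto
  have lin: "linear_map R ?F C ?f" by (intro free_lift_linear assms \<phi>)
  have gen: "?f (free_gen R (x, y)) = \<phi> x y" if "x \<in> carrier M" "y \<in> carrier N" for x y
    using free_lift_gen[OF assms(3) \<phi>, of "(x, y)"] that by simp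
  note simps = linear_map_add[OF lin] linear_map_smult[OF lin] gen free_gen_closed
    linear_map_add[OF bilinear_left[OF assms(4)]] linear_map_add[OF bilinear_right[OF assms(4)]]
    linear_map_smult[OF bilinear_left[OF assms(4)]] linear_map_smult[OF bilinear_right[OF assms(4)]]
  \<comment> \<open>Each of the four families of relations consists of differences, so a relation is
    killed as soon as the lift agrees on its two terms.\<close>
  have sub: "?f (q \<ominus>\<^bsub>?F\<^esub> q') = \<zero>\<^bsub>C\<^esub>"
    if "?f q = ?f q'" "q \<in> carrier ?F" "q' \<in> carrier ?F" for q q'
    unfolding linear_map_minus[OF F.module_axioms assms(3) lin that(2,3)] that(1)
    by (simp add: linear_map_closed[OF lin] a_minus_def C.M.r_neg that(3))
  have "bilinear_relations R M N \<subseteq> {q \<in> carrier ?F. ?f q = \<zero>\<^bsub>C\<^esub>}"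
  proof
    fix q assume q: "q \<in> bilinear_relations R M N"
    then have "q \<in> carrier ?F" using bilinear_relations_closed[OF assms(1,2)] by auto
    moreover have "?f q = \<zero>\<^bsub>C\<^esub>"
      using q unfolding bilinear_relations_def Let_def
      by (elim UnE CollectE exE conjE; hypsubst; intro sub)
        (simp_all add: simps)
    ultimately show "q \<in> {q \<in> carrier ?F. ?f q = \<zero>\<^bsub>C\<^esub>}" by simp
  qed
  then have "tensor_null R M N \<subseteq> {q \<in> carrier ?F. ?f q = \<zero>\<^bsub>C\<^esub>}"
    unfolding tensor_null_def
    by (intro submodule_span_least submodule_kernel F.module_axioms assms(3) lin)
  then show ?thesis using assms(5) by auto
qed

text \<open>Members of one coset differ by an element of \<open>tensor_null\<close>, which the lift
  kills. So the image of the coset is a singleton, and \<open>the_elem\<close> in the definition of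
  \<open>tensor_lift\<close> is determined.\<close>

lemma tensor_lift_coset:
  assumes "module R M" "module R N" "module R C" "bilinear R M N C \<phi>"
    and p: "p \<in> carrier (free_module R (carrier M \<times> carrier N))"
  shows "tensor_lift R C \<phi> (tensor_null R M N +>\<^bsub>free_module R (carrier M \<times> carrier N)\<^esub> p)
    = free_lift R C (\<lambda>(u, v). \<phi> u v) p"
proof -
  interpret C: module R C by fact
  let ?F = "free_module R (carrier M \<times> carrier N)"
  let ?f = "free_lift R C (\<lambda>(u, v). \<phi> u v)"
  interpret F: module R ?F by (rule module_free_module)
  interpret H: abelian_subgroup "tensor_null R M N" ?F
    by (intro abelian_subgroup_submodule[OF F.module_axioms] submodule_tensor_null assms)
  have lin: "linear_map R ?F C ?f"
    by (intro free_lift_linear assms) (use bilinear_closed[OF assms(4)] in auto)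
  have "?f q = ?f p" if "q \<in> tensor_null R M N +>\<^bsub>?F\<^esub> p" for q
  proof -
    from that obtain h where h: "h \<in> tensor_null R M N" "q = h \<oplus>\<^bsub>?F\<^esub> p"
      by (auto simp only: a_r_coset_def' UN_iff singleton_iff)
    then have "?f q = ?f h \<oplus>\<^bsub>C\<^esub> ?f p"
      using p H.a_subset by (simp only: linear_map_add[OF lin] subsetD)
    then show ?thesis
      using free_lift_tensor_null[OF assms(1-4) h(1)] linear_map_closed[OF lin p] by simp
  qed
  moreover have "p \<in> tensor_null R M N +>\<^bsub>?F\<^esub> p" using p by (rule H.a_rcos_self)
  ultimately have "?f ` (tensor_null R M N +>\<^bsub>?F\<^esub> p) = {?f p}" by blast
  then show ?thesis unfolding tensor_lift_def by simp
qed

lemma linear_map_free_ext: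
  assumes "module R C" "linear_map R (free_module R X) C f" "linear_map R (free_module R X) C g"
    and "\<And>x. x \<in> X \<Longrightarrow> f (free_gen R x) = g (free_gen R x)"
    and "p \<in> carrier (free_module R X)"
  shows "f p = g p"
  using assms(5)
proof (induction p rule: free_module_induct)
  case zero
  show ?case using assms(1-3) by (simp only: linear_map_zero[OF module_free_module])
next
  case (add p c x)
  interpret F: module R "free_module R X" by (rule module_free_module)
  note [simp del] = free_module_simps
  show ?case
    using add by (simp add: assms(4) free_gen_closed linear_map_add[OF assms(2)]
        linear_map_add[OF assms(3)] linear_map_smult[OF assms(2)] linear_map_smult[OF assms(3)])
qed

lemma tensor_carrierE:
  assumes "t \<in> carrier (tensor R M N)"
  obtains p where "p \<in> carrier (free_module R (carrier M \<times> carrier N))"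
    and "t = tensor_null R M N +>\<^bsub>free_module R (carrier M \<times> carrier N)\<^esub> p"
  using assms unfolding tensor_def quotient_carrier by blast

text \<open>Both maps are pulled back along the coset projection to the free module, where
  generators determine a linear map, and generators project to pure tensors. This is the uniqueness
  half of the universal property and the tool by which later identities are reduced to pure
  tensors.\<close>

lemma linear_map_tensor_ext:
  assumes "module R M" "module R N" "module R C"
    and f: "linear_map R (tensor R M N) C f" and g: "linear_map R (tensor R M N) C g"
    and eq: "\<And>x y. \<lbrakk>x \<in> carrier M; y \<in> carrier N\<rbrakk> \<Longrightarrow>
      f (pure_tensor R M N x y) = g (pure_tensor R M N x y)"
    and t: "t \<in> carrier (tensor R M N)"
  shows "f t = g t"
proof -
  let ?F = "free_module R (carrier M \<times> carrier N)"
  obtain p where p: "p \<in> carrier ?F" and t: "t = tensor_null R M N +>\<^bsub>?F\<^esub> p"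
    using t by (rule tensor_carrierE)
  note cl = tensor_coset_linear[OF assms(1,2)]
  show ?thesis
    unfolding t
    by (rule linear_map_free_ext[OF assms(3) linear_map_compose[OF cl f]
          linear_map_compose[OF cl g] _ p])
      (use eq in \<open>auto simp: pure_tensor_def\<close>)
qed

lemma tensor_lift_pure:
  assumes "module R M" "module R N" "module R C" "bilinear R M N C \<phi>"
    and "x \<in> carrier M" "y \<in> carrier N"
  shows "tensor_lift R C \<phi> (pure_tensor R M N x y) = \<phi> x y"
proof -
  have "tensor_lift R C \<phi> (pure_tensor R M N x y)
      = free_lift R C (\<lambda>(u, v). \<phi> u v) (free_gen R (x, y))"
    unfolding pure_tensor_def
    by (rule tensor_lift_coset[OF assms(1-4) free_gen_closed]) (simp add: assms(5,6))
  also have "\<dots> = (\<lambda>(u, v). \<phi> u v) (x, y)"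
    using assms(3) by (rule free_lift_gen[where X = "carrier M \<times> carrier N"])
      (use bilinear_closed[OF assms(4)] assms(5,6) in auto)
  finally show ?thesis by simp
qed

text \<open>Operations on cosets come from representatives, on which \<open>tensor_lift\<close> is
  the linear map \<open>free_lift\<close>. Together with \<open>tensor_lift_pure\<close> this is the
  existence half of the universal property.\<close>

lemma tensor_lift_linear:
  assumes "module R M" "module R N" "module R C" "bilinear R M N C \<phi>"
  shows "linear_map R (tensor R M N) C (tensor_lift R C \<phi>)"
proof -
  let ?F = "free_module R (carrier M \<times> carrier N)"
  interpret F: module R ?F by (rule module_free_module)
  note [simp del] = free_module_simps
  note cl = tensor_coset_linear[OF assms(1,2)]
  have lin: "linear_map R ?F C (free_lift R C (\<lambda>(u, v). \<phi> u v))"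
    by (intro free_lift_linear assms) (use bilinear_closed[OF assms(4)] in auto)
  note lift = tensor_lift_coset[OF assms]
  show ?thesis
  proof (rule linear_mapI)
    fix s assume "s \<in> carrier (tensor R M N)"
    then obtain p where p: "p \<in> carrier ?F" "s = tensor_null R M N +>\<^bsub>?F\<^esub> p"
      by (rule tensor_carrierE)
    then show "tensor_lift R C \<phi> s \<in> carrier C"
      by (simp add: lift linear_map_closed[OF lin])
    fix t assume "t \<in> carrier (tensor R M N)"
    then obtain q where q: "q \<in> carrier ?F" "t = tensor_null R M N +>\<^bsub>?F\<^esub> q"
      by (rule tensor_carrierE)
    show "tensor_lift R C \<phi> (s \<oplus>\<^bsub>tensor R M N\<^esub> t)
        = tensor_lift R C \<phi> s \<oplus>\<^bsub>C\<^esub> tensor_lift R C \<phi> t"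
      unfolding p(2) q(2) linear_map_add[OF cl p(1) q(1), symmetric]
      by (simp only: lift p(1) q(1) F.M.a_closed linear_map_add[OF lin])
  next
    fix c s assume c: "c \<in> carrier R" and "s \<in> carrier (tensor R M N)"
    then obtain p where p: "p \<in> carrier ?F" "s = tensor_null R M N +>\<^bsub>?F\<^esub> p"
      by (elim tensor_carrierE)
    show "tensor_lift R C \<phi> (c \<odot>\<^bsub>tensor R M N\<^esub> s) = c \<odot>\<^bsub>C\<^esub> tensor_lift R C \<phi> s"
      unfolding p(2) linear_map_smult[OF cl c p(1), symmetric]
      by (simp only: lift p(1) c F.smult_closed linear_map_smult[OF lin])
  qed
qed

text \<open>A difference that is itself a relation lies in the span and so vanishes in the quotient.
  In this form, each bilinearity law for pure tensors is matched against a single relation.\<close>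

lemma tensor_coset_eq:
  assumes "module R M" "module R N"
    and p: "p \<in> carrier (free_module R (carrier M \<times> carrier N))"
    and q: "q \<in> carrier (free_module R (carrier M \<times> carrier N))"
    and "p \<ominus>\<^bsub>free_module R (carrier M \<times> carrier N)\<^esub> q \<in> bilinear_relations R M N"
  shows "tensor_null R M N +>\<^bsub>free_module R (carrier M \<times> carrier N)\<^esub> p
    = tensor_null R M N +>\<^bsub>free_module R (carrier M \<times> carrier N)\<^esub> q"
proof -
  let ?F = "free_module R (carrier M \<times> carrier N)"
  interpret F: module R ?F by (rule module_free_module)
  interpret H: abelian_subgroup "tensor_null R M N" ?F
    by (intro abelian_subgroup_submodule[OF F.module_axioms] submodule_tensor_null assms)
  have "p \<ominus>\<^bsub>?F\<^esub> q \<in> tensor_null R M N"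
    unfolding tensor_null_def by (rule subsetD[OF submodule_span_superset assms(5)])
  then have "p \<in> tensor_null R M N +>\<^bsub>?F\<^esub> q"
    unfolding a_minus_def by (rule H.a_rcos_module_rev[OF q p])
  then show ?thesis
    by (rule H.a_repr_independence'[symmetric, OF _ q])
qed

text \<open>Additivity and homogeneity in either variable correspond one by one to the four families
  of relations, once linearity of the projection moves the operations inside the coset.\<close>

lemma bilinear_pure_tensor:
  assumes "module R M" "module R N"
  shows "bilinear R M N (tensor R M N) (pure_tensor R M N)"
proof -
  let ?F = "free_module R (carrier M \<times> carrier N)" and ?T = "tensor R M N"
  interpret M: module R M by fact
  interpret N: module R N by fact
  interpret F: module R ?F by (rule module_free_module)
  note [simp del] = free_module_simps
  note cl = tensor_coset_linear[OF assms]
  have gen: "free_gen R (x, y) \<in> carrier ?F" if "x \<in> carrier M" "y \<in> carrier N" for x y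
    using that by (simp add: free_gen_closed)
  note eq = tensor_coset_eq[OF assms]
  show ?thesis
  proof (intro bilinearI linear_mapI)
    fix x x' y assume x: "x \<in> carrier M" "x' \<in> carrier M" and y: "y \<in> carrier N"
    show "pure_tensor R M N (x \<oplus>\<^bsub>M\<^esub> x') y = pure_tensor R M N x y \<oplus>\<^bsub>?T\<^esub> pure_tensor R M N x' y"
      unfolding pure_tensor_def linear_map_add[OF cl gen[OF x(1) y] gen[OF x(2) y], symmetric]
      by (rule eq; (simp add: x y gen; fail)?)
        (unfold bilinear_relations_def Let_def, use x y in blast)
  next
    fix x y y' assume x: "x \<in> carrier M" and y: "y \<in> carrier N" "y' \<in> carrier N"
    show "pure_tensor R M N x (y \<oplus>\<^bsub>N\<^esub> y') = pure_tensor R M N x y \<oplus>\<^bsub>?T\<^esub> pure_tensor R M N x y'"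
      unfolding pure_tensor_def linear_map_add[OF cl gen[OF x y(1)] gen[OF x y(2)], symmetric]
      by (rule eq; (simp add: x y gen; fail)?)
        (unfold bilinear_relations_def Let_def, use x y in blast)
  next
    fix c x y assume c: "c \<in> carrier R" and x: "x \<in> carrier M" and y: "y \<in> carrier N"
    show "pure_tensor R M N (c \<odot>\<^bsub>M\<^esub> x) y = c \<odot>\<^bsub>?T\<^esub> pure_tensor R M N x y"
      unfolding pure_tensor_def linear_map_smult[OF cl c gen[OF x y], symmetric]
      by (rule eq; (simp add: c x y gen; fail)?)
        (unfold bilinear_relations_def Let_def, use c x y in blast)
    show "pure_tensor R M N x (c \<odot>\<^bsub>N\<^esub> y) = c \<odot>\<^bsub>?T\<^esub> pure_tensor R M N x y"
      unfolding pure_tensor_def linear_map_smult[OF cl c gen[OF x y], symmetric]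
      by (rule eq; (simp add: c x y gen; fail)?)
        (unfold bilinear_relations_def Let_def, use c x y in blast)
  next
    fix x y assume "x \<in> carrier M" "y \<in> carrier N"
    then show "pure_tensor R M N x y \<in> carrier ?T" "pure_tensor R M N x y \<in> carrier ?T"
      unfolding pure_tensor_def by (simp_all only: linear_map_closed[OF cl gen])
  qed
qed

section \<open>Maps between tensor products\<close>

text \<open>The inner map \<open>f\<close> is built in so that this rule and its right-hand
  counterpart, used as introduction rules, peel nested tensors one factor at a time.\<close>

lemma linear_map_pure_left:
  assumes "module R M" "module R N" "linear_map R P M f" "y \<in> carrier N"
  shows "linear_map R P (tensor R M N) (\<lambda>x. pure_tensor R M N (f x) y)"
  by (rule linear_map_compose[OF assms(3) bilinear_left[OF bilinear_pure_tensor[OF assms(1,2)] assms(4)]])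

lemma linear_map_pure_right:
  assumes "module R M" "module R N" "linear_map R P N f" "x \<in> carrier M"
  shows "linear_map R P (tensor R M N) (\<lambda>y. pure_tensor R M N x (f y))"
  by (rule linear_map_compose[OF assms(3) bilinear_right[OF bilinear_pure_tensor[OF assms(1,2)] assms(4)]])

lemma pure_tensor_closed:
  "\<lbrakk>module R M; module R N; x \<in> carrier M; y \<in> carrier N\<rbrakk>
    \<Longrightarrow> pure_tensor R M N x y \<in> carrier (tensor R M N)"
  by (rule bilinear_closed[OF bilinear_pure_tensor])

text \<open>Both sides are linear in \<open>t\<close> and agree on pure tensors: this is naturality
  of the lift. Since \<open>\<psi>\<close> is compared with \<open>h\<close> after
  \<open>\<phi>\<close> only on carriers, its bilinearity is obtained by congruence.\<close>

lemma linear_map_tensor_lift: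
  assumes "module R M" "module R N" "module R C" "module R D"
    and "bilinear R M N C \<phi>" "linear_map R C D h"
    and "\<And>x y. \<lbrakk>x \<in> carrier M; y \<in> carrier N\<rbrakk> \<Longrightarrow> \<psi> x y = h (\<phi> x y)"
    and "t \<in> carrier (tensor R M N)"
  shows "tensor_lift R D \<psi> t = h (tensor_lift R C \<phi> t)"
proof -
  have bil: "bilinear R M N D \<psi>"
  proof (rule bilinearI)
    fix x assume x: "x \<in> carrier M"
    show "linear_map R N D (\<lambda>y. \<psi> x y)"
      by (rule linear_map_cong[OF assms(2) linear_map_compose[OF bilinear_right[OF assms(5) x] assms(6)]])
        (rule assms(7)[OF x])
  next
    fix y assume y: "y \<in> carrier N"
    show "linear_map R M D (\<lambda>x. \<psi> x y)"
      by (rule linear_map_cong[OF assms(1) linear_map_compose[OF bilinear_left[OF assms(5) y] assms(6)]])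
        (rule assms(7)[OF _ y])
  qed
  show ?thesis
    by (rule linear_map_tensor_ext[OF assms(1,2,4) tensor_lift_linear[OF assms(1,2,4) bil]
          linear_map_compose[OF tensor_lift_linear[OF assms(1,2,3,5)] assms(6)] _ assms(8)])
      (simp add: tensor_lift_pure assms bil)
qed

text \<open>For fixed parameters both sides of each law are linear in \<open>t\<close>, so pure
  tensors suffice, and there the law is linearity of \<open>\<phi>\<close> in \<open>z\<close>.
  Nested lifts need this, as in the associators and in the double sum of
  \<open>AHYB\<close>.\<close>

lemma tensor_lift_linear_param:
  assumes "module R M" "module R N" "module R C" "module R P"
    and bil: "\<And>z. z \<in> carrier P \<Longrightarrow> bilinear R M N C (\<phi> z)"
    and lin: "\<And>x y. \<lbrakk>x \<in> carrier M; y \<in> carrier N\<rbrakk> \<Longrightarrow> linear_map R P C (\<lambda>z. \<phi> z x y)"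
    and t: "t \<in> carrier (tensor R M N)"
  shows "linear_map R P C (\<lambda>z. tensor_lift R C (\<phi> z) t)"
proof (rule linear_mapI)
  interpret P: module R P by fact
  note tl = tensor_lift_linear[OF assms(1-3) bil]
  note pure = tensor_lift_pure[OF assms(1-3) bil]
  fix z assume z: "z \<in> carrier P"
  show "tensor_lift R C (\<phi> z) t \<in> carrier C"
    by (rule linear_map_closed[OF tl[OF z] t])
  fix z' assume z': "z' \<in> carrier P"
  have zz: "z \<oplus>\<^bsub>P\<^esub> z' \<in> carrier P" using z z' by (rule P.M.a_closed)
  show "tensor_lift R C (\<phi> (z \<oplus>\<^bsub>P\<^esub> z')) t
      = tensor_lift R C (\<phi> z) t \<oplus>\<^bsub>C\<^esub> tensor_lift R C (\<phi> z') t"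
    by (rule linear_map_tensor_ext[OF assms(1-3) tl[OF zz]
          linear_map_plus[OF assms(3) tl[OF z] tl[OF z']] _ t])
      (simp add: pure z z' zz linear_map_add[OF lin])
next
  interpret P: module R P by fact
  note tl = tensor_lift_linear[OF assms(1-3) bil]
  note pure = tensor_lift_pure[OF assms(1-3) bil]
  fix c z assume c: "c \<in> carrier R" and z: "z \<in> carrier P"
  then have cz: "c \<odot>\<^bsub>P\<^esub> z \<in> carrier P" by (rule P.smult_closed)
  show "tensor_lift R C (\<phi> (c \<odot>\<^bsub>P\<^esub> z)) t = c \<odot>\<^bsub>C\<^esub> tensor_lift R C (\<phi> z) t"
    by (rule linear_map_tensor_ext[OF assms(1-3) tl[OF cz]
          linear_map_scaled[OF assms(3) tl[OF z] c] _ t])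
      (simp add: pure c z cz linear_map_smult[OF lin])
qed

lemma bilinear_compose:
  assumes "bilinear R M N C \<phi>" "linear_map R P M f" "linear_map R Q N g"
  shows "bilinear R P Q C (\<lambda>x y. \<phi> (f x) (g y))"
  by (rule bilinearI)
    (rule linear_map_compose[OF assms(3) bilinear_right[OF assms(1) linear_map_closed[OF assms(2)]]]
      linear_map_compose[OF assms(2) bilinear_left[OF assms(1) linear_map_closed[OF assms(3)]]],
      assumption)+

lemma bilinear_tensor_map:
  assumes "module R M" "module R N" "linear_map R P M f" "linear_map R Q N g"
  shows "bilinear R P Q (tensor R M N) (\<lambda>u v. pure_tensor R M N (f u) (g v))"
  by (rule bilinear_compose[OF bilinear_pure_tensor assms(3,4)]) fact+

lemma tensor_map_linear:
  assumes "module R M" "module R N" "module R P" "module R Q"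
    and "linear_map R P M f" "linear_map R Q N g"
  shows "linear_map R (tensor R P Q) (tensor R M N) (tensor_map R M N f g)"
  unfolding tensor_map_def by (intro tensor_lift_linear module_tensor bilinear_tensor_map assms)

lemma tensor_map_pure:
  assumes "module R M" "module R N" "module R P" "module R Q"
    and "linear_map R P M f" "linear_map R Q N g" "x \<in> carrier P" "y \<in> carrier Q"
  shows "tensor_map R M N f g (pure_tensor R P Q x y) = pure_tensor R M N (f x) (g y)"
  unfolding tensor_map_def by (intro tensor_lift_pure module_tensor bilinear_tensor_map assms)

text \<open>This is substitution in a sum over \<open>t\<close>: both sides are linear and take the
  same value on each pure tensor.\<close>

lemma tensor_lift_tensor_map:
  assumes "module R M" "module R N" "module R P" "module R Q" "module R C"
    and f: "linear_map R P M f" and g: "linear_map R Q N g" and bil: "bilinear R M N C \<phi>"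
    and "t \<in> carrier (tensor R P Q)"
  shows "tensor_lift R C \<phi> (tensor_map R M N f g t) = tensor_lift R C (\<lambda>u v. \<phi> (f u) (g v)) t"
  by (rule linear_map_tensor_ext[OF assms(3-5) linear_map_compose[OF tensor_map_linear[OF assms(1-4) f g]
        tensor_lift_linear[OF assms(1,2,5) bil]]
        tensor_lift_linear[OF assms(3-5) bilinear_compose[OF bil f g]] _ assms(9)])
    (simp add: tensor_map_pure tensor_lift_pure assms bilinear_compose[OF bil f g]
      linear_map_closed[OF f] linear_map_closed[OF g])

text \<open>Functoriality is the substitution rule applied to the lift that defines the outer tensor
  map.\<close>

lemma tensor_map_compose:
  assumes "module R M" "module R N" "module R P" "module R Q" "module R U" "module R V"
    and f: "linear_map R P M f" and g: "linear_map R Q N g"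
    and f': "linear_map R U P f'" and g': "linear_map R V Q g'"
    and "t \<in> carrier (tensor R U V)"
  shows "tensor_map R M N f g (tensor_map R P Q f' g' t)
    = tensor_map R M N (\<lambda>x. f (f' x)) (\<lambda>y. g (g' y)) t"
  unfolding tensor_map_def[of R M N]
  by (rule tensor_lift_tensor_map[OF assms(3-6) module_tensor[OF assms(1,2)] f' g'
        bilinear_tensor_map[OF assms(1,2) f g] assms(11)])

text \<open>The nested lift is linear in the inner tensor by \<open>tensor_lift_linear\<close> and
  in the outer factor by \<open>tensor_lift_linear_param\<close>, so the outer lift is taken of a
  bilinear map. The same argument serves \<open>assoc_right\<close>.\<close>

lemma assoc_left_linear:
  assumes A: "module R A"
  shows "linear_map R (tensor R A (tensor R A A)) (tensor R (tensor R A A) A) (assoc_left R A)"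
proof -
  note lin = linear_map_pure_left linear_map_pure_right linear_map_id[unfolded id_def]
  note mods = A module_tensor[OF A A] module_tensor[OF module_tensor[OF A A] A]
  have bil: "bilinear R A A (tensor R (tensor R A A) A)
      (\<lambda>b c. pure_tensor R (tensor R A A) A (pure_tensor R A A a b) c)" if "a \<in> carrier A" for a
    using that by (intro bilinearI lin mods pure_tensor_closed)
  show ?thesis
    unfolding assoc_left_def
  proof (rule tensor_lift_linear[OF mods], rule bilinearI, goal_cases)
    case (1 a)
    then show ?case by (rule tensor_lift_linear[OF A A mods(3) bil])
  next
    case (2 t)
    show ?case
      by (rule tensor_lift_linear_param[OF A A mods(3) A bil _ 2])
        (assumption, intro lin mods)
  qed
qed

lemma assoc_right_linear:
  assumes A: "module R A"
  shows "linear_map R (tensor R (tensor R A A) A) (tensor R A (tensor R A A)) (assoc_right R A)"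
proof -
  note lin = linear_map_pure_left linear_map_pure_right linear_map_id[unfolded id_def]
  note mods = A module_tensor[OF A A] module_tensor[OF A module_tensor[OF A A]]
  have bil: "bilinear R A A (tensor R A (tensor R A A))
      (\<lambda>a b. pure_tensor R A (tensor R A A) a (pure_tensor R A A b c))" if "c \<in> carrier A" for c
    using that by (intro bilinearI lin mods pure_tensor_closed)
  show ?thesis
    unfolding assoc_right_def
  proof (rule tensor_lift_linear[OF mods(2,1,3)], rule bilinearI, goal_cases)
    case (1 t)
    show ?case
      by (rule tensor_lift_linear_param[OF A A mods(3) A bil _ 1])
        (assumption, intro lin mods pure_tensor_closed)
  next
    case (2 c)
    then show ?case by (rule tensor_lift_linear[OF A A mods(3) bil])
  qed
qed

end

section \<open>Twisting a quasi-triangular \<open>\<epsilon>\<close>-bialgebra\<close>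

locale twisted_quasi_triangular_epsilon_bialgebra = quasi_triangular_epsilon_bialgebra K A \<mu> \<Delta> r
  for K (structure) and A (structure) and \<mu> \<Delta> r +
  fixes \<alpha>
  assumes morphism: "algebra_morphism K A \<mu> A \<mu> \<alpha>"
    and morphism_r: "tensor_map K A A \<alpha> \<alpha> r = r"
begin

section \<open>Notation and the action of the twist on tensor powers\<close>

abbreviation "A2 \<equiv> tensor K A A"
abbreviation "A3 \<equiv> tensor K A A2"
abbreviation "t2 \<equiv> pure_tensor K A A"
abbreviation "t3 x y z \<equiv> pure_tensor K A A2 x (t2 y z)"
abbreviation "\<alpha>2 \<equiv> tensor_map K A A \<alpha> \<alpha>"
abbreviation "\<alpha>3 \<equiv> tensor_map K A A2 \<alpha> \<alpha>2"

lemma A_module: "module K A" ..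

text \<open>Later instantiations select by position: 1 is \<open>A\<close>, 2 is \<open>A2\<close>,
  3 is \<open>A3\<close>, and 4 is the tensor product bracketed to the left.\<close>

lemmas modules = A_module module_tensor[OF A_module A_module]
  module_tensor[OF A_module module_tensor[OF A_module A_module]]
  module_tensor[OF module_tensor[OF A_module A_module] A_module]

lemma \<alpha>_linear: "linear_map K A A \<alpha>"
  using morphism unfolding algebra_morphism_def by blast

lemma \<alpha>2_linear: "linear_map K A2 A2 \<alpha>2"
  by (intro tensor_map_linear modules \<alpha>_linear)

lemma \<alpha>3_linear: "linear_map K A3 A3 \<alpha>3"
  by (intro tensor_map_linear modules \<alpha>_linear \<alpha>2_linear)

lemma \<alpha>_mult: "x \<in> carrier A2 \<Longrightarrow> \<alpha> (\<mu> x) = \<mu> (\<alpha>2 x)"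
  using morphism unfolding algebra_morphism_def by blast

lemma \<alpha>2_pure: "\<lbrakk>x \<in> carrier A; y \<in> carrier A\<rbrakk> \<Longrightarrow> \<alpha>2 (t2 x y) = t2 (\<alpha> x) (\<alpha> y)"
  by (intro tensor_map_pure modules \<alpha>_linear)

lemma t2_closed: "\<lbrakk>x \<in> carrier A; y \<in> carrier A\<rbrakk> \<Longrightarrow> t2 x y \<in> carrier A2"
  by (intro pure_tensor_closed modules)

lemma \<alpha>3_pure:
  "\<lbrakk>x \<in> carrier A; y \<in> carrier A; z \<in> carrier A\<rbrakk> \<Longrightarrow> \<alpha>3 (t3 x y z) = t3 (\<alpha> x) (\<alpha> y) (\<alpha> z)"
  by (subst tensor_map_pure[OF modules(1,2) modules(1,2) \<alpha>_linear \<alpha>2_linear])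
    (simp_all add: t2_closed \<alpha>2_pure)

lemmas closed = linear_map_closed[OF \<alpha>_linear] linear_map_closed[OF \<alpha>2_linear]
  linear_map_closed[OF mult_linear] linear_map_closed[OF comult_linear] t2_closed

lemma linear_map_mult: "linear_map K M A2 f \<Longrightarrow> linear_map K M A (\<lambda>x. \<mu> (f x))"
  by (rule linear_map_compose[OF _ mult_linear])

text \<open>Expressions built from pure tensors, \<open>\<mu>\<close>, sums and differences are
  decomposed by these rules until only the identity map remains, which makes linearity of the
  bracket and of \<open>AHYB\<close> in each variable mechanical.\<close>

lemmas linear_intros = linear_map_plus linear_map_diff linear_map_mult
  linear_map_pure_left linear_map_pure_right linear_map_id[unfolded id_def]

text \<open>For the first equation, each twisted summand is \<open>\<alpha>2\<close> of the
  untwisted one. For the second, multiplicativity turns the twisted product of \<open>a\<close> and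
  \<open>u\<close> into the product of \<open>\<alpha> a\<close> and \<open>\<alpha> u\<close>, so
  the summand is the untwisted one for \<open>\<alpha> a\<close> after substituting images under
  \<open>\<alpha>\<close>; invariance of \<open>r\<close> absorbs the substitution.\<close>

lemma twisted_star_bracket:
  assumes a: "a \<in> carrier A"
  shows "star_bracket K A (\<alpha> \<circ> \<mu>) \<alpha> a r = \<alpha>2 (\<Delta> a)"
    and "star_bracket K A (\<alpha> \<circ> \<mu>) \<alpha> a r = \<Delta> (\<alpha> a)"
proof -
  have bil: "bilinear K A A A2 (\<lambda>u v. t2 (\<mu> (t2 b u)) v \<ominus>\<^bsub>A2\<^esub> t2 u (\<mu> (t2 v b)))"
    if "b \<in> carrier A" for b
    using that by (intro bilinearI linear_intros modules closed)
  show "star_bracket K A (\<alpha> \<circ> \<mu>) \<alpha> a r = \<alpha>2 (\<Delta> a)"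
    unfolding bspec[OF comult_eq a] star_bracket_def id_apply
    by (rule linear_map_tensor_lift[OF modules(1,1,2,2) bil[OF a] \<alpha>2_linear _ r_closed])
      (simp add: linear_map_minus[OF modules(2,2) \<alpha>2_linear] a closed \<alpha>2_pure)
  \<comment> \<open>Naturality is used here with the identity as outer map. It then acts as a
    congruence rule, because the two summands are known to agree only on carriers.\<close>
  have "star_bracket K A (\<alpha> \<circ> \<mu>) \<alpha> a r = star_bracket K A \<mu> id (\<alpha> a) (\<alpha>2 r)"
    unfolding star_bracket_def id_apply
      tensor_lift_tensor_map[OF modules(1,1,1,1,2) \<alpha>_linear \<alpha>_linear
        bil[OF linear_map_closed[OF \<alpha>_linear a]] r_closed]
    by (rule linear_map_tensor_lift[OF modules(1,1,2,2) bilinear_compose[OF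
          bil[OF linear_map_closed[OF \<alpha>_linear a]] \<alpha>_linear \<alpha>_linear]
          linear_map_id _ r_closed, unfolded id_apply])
      (simp add: a closed \<alpha>2_pure \<alpha>_mult)
  then show "star_bracket K A (\<alpha> \<circ> \<mu>) \<alpha> a r = \<Delta> (\<alpha> a)"
    using comult_eq a by (simp add: morphism_r closed)
qed

lemma \<alpha>2_comult: "a \<in> carrier A \<Longrightarrow> \<alpha>2 (\<Delta> a) = \<Delta> (\<alpha> a)"
  using twisted_star_bracket by metis

text \<open>In every term of the twisted sum \<open>\<alpha>\<close> acts on all three legs, on one
  of them through the twisted product. So each summand is \<open>\<alpha>3\<close> of the untwisted
  one, and naturality for the outer and the inner lift moves \<open>\<alpha>3\<close> out of the
  double sum.\<close>

lemma AHYB_twisted: "AHYB K A (\<alpha> \<circ> \<mu>) \<alpha> r = \<alpha>3 (AHYB K A \<mu> id r)"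
proof -
  let ?\<phi> = "\<lambda>u v u' v'. (t3 (\<mu> (t2 u u')) v' v \<ominus>\<^bsub>A3\<^esub> t3 u (\<mu> (t2 v u')) v')
      \<oplus>\<^bsub>A3\<^esub> t3 u' u (\<mu> (t2 v v'))"
  have bil: "bilinear K A A A3 (\<lambda>u' v'. ?\<phi> u v u' v')" if "u \<in> carrier A" "v \<in> carrier A" for u v
    using that by (intro bilinearI linear_intros modules closed)
  \<comment> \<open>Linearity of the inner sum in one outer variable comes from the parameter rule,
    with the other outer variable held fixed.\<close>
  have bil': "bilinear K A A A3 (\<lambda>u v. tensor_lift K A3 (\<lambda>u' v'. ?\<phi> u v u' v') r)"
    by (rule bilinearI;
        rule tensor_lift_linear_param[OF modules(1,1,3,1) bil _ r_closed], assumption, assumption)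
      (intro linear_intros modules closed; assumption)+
  interpret A3: module K A3 by (rule modules)
  have eq: "(t3 (\<alpha> (\<mu> (t2 u u'))) (\<alpha> v') (\<alpha> v) \<ominus>\<^bsub>A3\<^esub> t3 (\<alpha> u) (\<alpha> (\<mu> (t2 v u'))) (\<alpha> v'))
      \<oplus>\<^bsub>A3\<^esub> t3 (\<alpha> u') (\<alpha> u) (\<alpha> (\<mu> (t2 v v'))) = \<alpha>3 (?\<phi> u v u' v')"
    if "u \<in> carrier A" "v \<in> carrier A" "u' \<in> carrier A" "v' \<in> carrier A" for u v u' v'
    using that
    by (simp add: linear_map_add[OF \<alpha>3_linear] linear_map_minus[OF modules(3,3) \<alpha>3_linear]
        \<alpha>3_pure closed pure_tensor_closed[OF modules(1,2)])
  show ?thesis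
    unfolding AHYB_def Let_def id_apply comp_apply
    by (rule linear_map_tensor_lift[OF modules(1,1,3,3) bil' \<alpha>3_linear _ r_closed],
        rule linear_map_tensor_lift[OF modules(1,1,3,3) bil \<alpha>3_linear _ r_closed])
      (assumption | rule eq)+
qed

section \<open>Factoring the twist out of the structure maps\<close>

abbreviation "A3' \<equiv> tensor K A2 A"

lemmas tensor_maps_linear = tensor_map_linear[OF modules(1,1,1,2) linear_map_id mult_linear]
  tensor_map_linear[OF modules(1,1,2,1) mult_linear linear_map_id]
  tensor_map_linear[OF modules(1,2,1,1) linear_map_id comult_linear]
  tensor_map_linear[OF modules(2,1,1,1) comult_linear linear_map_id]

text \<open>By functoriality the twist separates from the structure map. For products it is pulled
  out to the left as \<open>\<alpha>2\<close>; for coproducts, in the lemmas below, it is moved into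
  the argument. What remains are the maps of the untwisted axioms.\<close>

lemma twisted_mult_right:
  "x \<in> carrier A3 \<Longrightarrow> tensor_map K A A \<alpha> (\<alpha> \<circ> \<mu>) x = \<alpha>2 (tensor_map K A A id \<mu> x)"
  by (simp add: tensor_map_compose[OF modules(1,1,1,1,1,2) \<alpha>_linear \<alpha>_linear linear_map_id mult_linear]
      comp_def)

lemma twisted_mult_left:
  "x \<in> carrier A3' \<Longrightarrow> tensor_map K A A (\<alpha> \<circ> \<mu>) \<alpha> x = \<alpha>2 (tensor_map K A A \<mu> id x)"
  by (simp add: tensor_map_compose[OF modules(1,1,1,1,2,1) \<alpha>_linear \<alpha>_linear mult_linear linear_map_id]
      comp_def)

lemma twisted_comult_right:
  "x \<in> carrier A2 \<Longrightarrow> tensor_map K A A2 \<alpha> (\<Delta> \<circ> \<alpha>) x = tensor_map K A A2 id \<Delta> (\<alpha>2 x)"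
  by (simp add: tensor_map_compose[OF modules(1,2,1,1,1,1) linear_map_id comult_linear \<alpha>_linear \<alpha>_linear]
      comp_def)

lemma twisted_comult_left:
  "x \<in> carrier A2 \<Longrightarrow> tensor_map K A2 A (\<Delta> \<circ> \<alpha>) \<alpha> x = tensor_map K A2 A \<Delta> id (\<alpha>2 x)"
  by (simp add: tensor_map_compose[OF modules(2,1,1,1,1,1) comult_linear linear_map_id \<alpha>_linear \<alpha>_linear]
      comp_def)

lemmas tensor_closed = closed tensor_maps_linear[THEN linear_map_closed]
  linear_map_closed[OF assoc_left_linear[OF A_module]]
  linear_map_closed[OF assoc_right_linear[OF A_module]]

section \<open>The Hom-bialgebra axioms for the twisted maps\<close>

lemma twisted_epsilon_Hom_bialgebra: "epsilon_Hom_bialgebra K A (\<alpha> \<circ> \<mu>) (\<Delta> \<circ> \<alpha>) \<alpha>"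
proof unfold_locales
  show "linear_map K A2 A (\<alpha> \<circ> \<mu>)"
    unfolding comp_def by (rule linear_map_compose[OF mult_linear \<alpha>_linear])
  show "linear_map K A A2 (\<Delta> \<circ> \<alpha>)"
    unfolding comp_def by (rule linear_map_compose[OF \<alpha>_linear comult_linear])
  show "linear_map K A A \<alpha>" by (rule \<alpha>_linear)
  show "\<forall>x\<in>carrier A2. \<alpha> ((\<alpha> \<circ> \<mu>) x) = (\<alpha> \<circ> \<mu>) (\<alpha>2 x)"
    by (simp add: \<alpha>_mult)
  \<comment> \<open>Multiplicativity is applied from right to left, so both sides become two
    applications of \<open>\<alpha>\<close> to the two sides of untwisted associativity.\<close>
  show "\<forall>x\<in>carrier A3. (\<alpha> \<circ> \<mu>) (tensor_map K A A \<alpha> (\<alpha> \<circ> \<mu>) x)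
      = (\<alpha> \<circ> \<mu>) (tensor_map K A A (\<alpha> \<circ> \<mu>) \<alpha> (assoc_left K A x))"
    using Hom_assoc
    by (simp add: twisted_mult_right twisted_mult_left tensor_closed \<alpha>_mult[symmetric])
  show "\<forall>a\<in>carrier A. \<alpha>2 ((\<Delta> \<circ> \<alpha>) a) = (\<Delta> \<circ> \<alpha>) (\<alpha> a)"
    by (simp add: \<alpha>2_comult closed)
  \<comment> \<open>Moving \<open>\<alpha>2\<close> through \<open>\<Delta>\<close> reduces this to
    untwisted coassociativity at \<open>\<alpha> (\<alpha> a)\<close>.\<close>
  show "\<forall>a\<in>carrier A. tensor_map K A A2 \<alpha> (\<Delta> \<circ> \<alpha>) ((\<Delta> \<circ> \<alpha>) a)
      = assoc_right K A (tensor_map K A2 A (\<Delta> \<circ> \<alpha>) \<alpha> ((\<Delta> \<circ> \<alpha>) a))"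
    using Hom_coassoc
    by (simp add: twisted_comult_right twisted_comult_left tensor_closed \<alpha>2_comult)
  show "\<forall>x\<in>carrier A2. (\<Delta> \<circ> \<alpha>) ((\<alpha> \<circ> \<mu>) x)
      = tensor_map K A A (\<alpha> \<circ> \<mu>) \<alpha> (assoc_left K A (tensor_map K A A2 \<alpha> (\<Delta> \<circ> \<alpha>) x))
        \<oplus>\<^bsub>A2\<^esub> tensor_map K A A \<alpha> (\<alpha> \<circ> \<mu>) (assoc_right K A (tensor_map K A2 A (\<Delta> \<circ> \<alpha>) \<alpha> x))"
  proof
    fix x assume x: "x \<in> carrier A2"
    \<comment> \<open>Of the two copies of \<open>\<alpha>\<close> between \<open>\<Delta>\<close>
      and \<open>\<mu>\<close>, one leaves through \<open>\<Delta>\<close> and the other enters the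
      argument of \<open>\<mu>\<close>. The untwisted axiom then applies at
      \<open>\<alpha>2 x\<close>, and the outer \<open>\<alpha>2\<close> is distributed over its two
      summands.\<close>
    have "(\<Delta> \<circ> \<alpha>) ((\<alpha> \<circ> \<mu>) x) = \<alpha>2 (\<Delta> (\<mu> (\<alpha>2 x)))"
      using x by (simp add: \<alpha>2_comult \<alpha>_mult tensor_closed)
    also have "\<Delta> (\<mu> (\<alpha>2 x)) = tensor_map K A A \<mu> id (assoc_left K A (tensor_map K A A2 id \<Delta> (\<alpha>2 x)))
        \<oplus>\<^bsub>A2\<^esub> tensor_map K A A id \<mu> (assoc_right K A (tensor_map K A2 A \<Delta> id (\<alpha>2 x)))"
      using comult_mult x by (simp add: closed)
    finally show "(\<Delta> \<circ> \<alpha>) ((\<alpha> \<circ> \<mu>) x)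
      = tensor_map K A A (\<alpha> \<circ> \<mu>) \<alpha> (assoc_left K A (tensor_map K A A2 \<alpha> (\<Delta> \<circ> \<alpha>) x))
        \<oplus>\<^bsub>A2\<^esub> tensor_map K A A \<alpha> (\<alpha> \<circ> \<mu>) (assoc_right K A (tensor_map K A2 A (\<Delta> \<circ> \<alpha>) \<alpha> x))"
      using x by (simp add: twisted_comult_right twisted_comult_left twisted_mult_right
          twisted_mult_left tensor_closed linear_map_add[OF \<alpha>2_linear])
  qed
qed

section \<open>The quasi-triangular structure\<close>

lemma twisted_quasi_triangular:
  "quasi_triangular_epsilon_Hom_bialgebra K A (\<alpha> \<circ> \<mu>) (\<Delta> \<circ> \<alpha>) \<alpha> r"
proof (intro quasi_triangular_epsilon_Hom_bialgebra.intro coboundary_epsilon_Hom_bialgebra.intro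
    coboundary_epsilon_Hom_bialgebra_axioms.intro
    quasi_triangular_epsilon_Hom_bialgebra_axioms.intro)
  show "epsilon_Hom_bialgebra K A (\<alpha> \<circ> \<mu>) (\<Delta> \<circ> \<alpha>) \<alpha>"
    by (rule twisted_epsilon_Hom_bialgebra)
  show "r \<in> carrier A2" by (rule r_closed)
  show "\<alpha>2 r = r" by (rule morphism_r)
  show "\<forall>a\<in>carrier A. (\<Delta> \<circ> \<alpha>) a = star_bracket K A (\<alpha> \<circ> \<mu>) \<alpha> a r"
    by (simp add: twisted_star_bracket(2))
  show "AHYB K A (\<alpha> \<circ> \<mu>) \<alpha> r = \<zero>\<^bsub>A3\<^esub>"
    unfolding AHYB_twisted AHYBE by (rule linear_map_zero[OF modules(3,3) \<alpha>3_linear])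
qed

end

theorem corollary5p7:
  fixes K :: "('k, 'r) ring_scheme"
    and A :: "('k, 'a, 'm) module_scheme"
    and \<mu> :: "('a \<times> 'a \<Rightarrow> 'k) set \<Rightarrow> 'a"
    and \<Delta> :: "'a \<Rightarrow> ('a \<times> 'a \<Rightarrow> 'k) set"
    and \<alpha> :: "'a \<Rightarrow> 'a"
    and r :: "('a \<times> 'a \<Rightarrow> 'k) set"
  assumes "quasi_triangular_epsilon_bialgebra K A \<mu> \<Delta> r"
    and "algebra_morphism K A \<mu> A \<mu> \<alpha>"
    and "tensor_map K A A \<alpha> \<alpha> r = r"
  shows "quasi_triangular_epsilon_Hom_bialgebra K A (\<alpha> \<circ> \<mu>) (\<Delta> \<circ> \<alpha>) \<alpha> r"
  using assms
  by (intro twisted_quasi_triangular_epsilon_bialgebra.twisted_quasi_triangular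
      twisted_quasi_triangular_epsilon_bialgebra.intro
      twisted_quasi_triangular_epsilon_bialgebra_axioms.intro)

end
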